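(* Let $G$ be a finite group acting on a Lie-Yamaguti algebra $(L,[\cdot,\cdot],\{\cdot,\cdot,\cdot\})$ over $\mathbb{K}$, and let $(f_t,g_t)$ and $(f'_t,g'_t)$ be two equivalent equivariant 1-parameter formal deformations of $L$, with $f_t=\sum_{i\ge 0}f_it^i$, $g_t=\sum_{i\ge 0}g_it^i$, $f'_t=\sum_{i\ge 0}f'_it^i$, $g'_t=\sum_{i\ge 0}g'_it^i$. Then the infinitesimal deformations $(f_1,g_1)$ and $(f'_1,g'_1)$ belong to the same cohomology class in $H_G^2(L,L)\times H_G^3(L,L)$.
   Context: $\mathbb{K}$ is an algebraically closed field of characteristic different from 2 and 3. **Lie-Yamaguti algebra.** A $\mathbb{K}$-vector space $L$ with a bilinear operation $[\cdot,\cdot]$ and a trilinear operation $\{\cdot,\cdot,\cdot\}$ such that for all $x,y,z,u,v,w\in L$ (where $\circlearrowleft_{(x,y,z)}$ denotes the sum over cyclic permutations of $x,y,z$): (LY1) $[x,y]=-[y,x]$; (LY2) $\{x,y,z\}=-\{y,x,z\}$; (LY3) $\circlearrowleft_{(x,y,z)}([[x,y],z]+\{x,y,z\})=0$; (LY4) $\circlearrowleft_{(x,y,z)}\{[x,y],z,u\}=0$; (LY5) $\{x,y,[u,v]\}=[\{x,y,u\},v]+[u,\{x,y,v\}]$; (LY6) $\{x,y,\{u,v,w\}\}=\{\{x,y,u\},v,w\}+\{u,\{x,y,v\},w\}+\{u,v,\{x,y,w\}\}$. The same definition is used over $\mathbb{K}[[t]]$ (with $\mathbb{K}[[t]]$-multilinear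 operations). **Group action.** A finite group $G$ acts on $L$ if there is a map $G\times L\to L$, $(\sigma,a)\mapsto\sigma a$, such that each $a\mapsto\sigma a$ is linear, $ea=a$, $\sigma(\tau a)=(\sigma\tau)a$, $\sigma[a,b]=[\sigma a,\sigma b]$ and $\sigma\{a,b,c\}=\{\sigma a,\sigma b,\sigma c\}$ for all $\sigma,\tau\in G$, $a,b,c\in L$. **Equivariant formal deformations.** $L[[t]]$ is the $\mathbb{K}[[t]]$-module of formal power series with coefficients in $L$. An equivariant 1-parameter formal deformation of $L$ is a pair $(f_t,g_t)$, $f_t=\sum_{i\ge0}f_it^i$, $g_t=\sum_{i\ge0}g_it^i$, with $f_0=[\cdot,\cdot]$, $g_0=\{\cdot,\cdot,\cdot\}$, each $f_i:L\times L\to L$ $\mathbb{K}$-bilinear and each $g_i:L\times L\times L\to L$ $\mathbb{K}$-trilinear (extended $\mathbb{K}[[t]]$-multilinearly to $L[[t]]$), such that $(L[[t]],f_t,g_t)$ is a Lie-Yamaguti algebra over $\mathbb{K}[[t]]$ and $f_i(\sigma a,\sigma b)=\sigma f_i(a,b)$, $g_i(\sigma a,\sigma b,\sigma c)=\sigma g_i(a,b,c)$ for all $a,b,c\in L$, $\sigma\in G$, $i\ge1$. The pair $(f_1,g_1)$ is its infinitesimal deformation. **Equivalence.** Equivariant deformations $(f_t,g_t)$ and $(f'_t,g'_t)$ are equivalent if there is a formal isomorphism of $\mathbb{K}[[t]]$-modules $\phi_t=\sum_{i\ge0}\phi_it^i:L[[t]]\to L[[t]]$, with each $\phi_i:L\to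 L$ $\mathbb{K}$-linear (extended $\mathbb{K}[[t]]$-linearly), $\phi_0=\mathrm{id}_L$, $\phi_i(\sigma x)=\sigma\phi_i(x)$ for all $i\ge0$, $\sigma\in G$, $x\in L$, such that $\phi_t(f_t(x,y))=f'_t(\phi_t(x),\phi_t(y))$ and $\phi_t(g_t(x,y,z))=g'_t(\phi_t(x),\phi_t(y),\phi_t(z))$. **Equivariant cohomology (adjoint coefficients).** $C^n(L,L)$ is the space of $n$-linear maps $f:L^n\to L$ with $f(x_1,\dots,x_n)=0$ whenever $x_{2i-1}=x_{2i}$ for some $i$ with $2i\le n$, and $C_G^n(L,L)=\{f\in C^n(L,L): f(\sigma x_1,\dots,\sigma x_n)=\sigma f(x_1,\dots,x_n)\ \forall\sigma\in G, x_i\in L\}$. For $h\in C^1(L,L)$: $\delta^1_Ih(x,y)=[x,h(y)]-[y,h(x)]-h([x,y])$, $\delta^1_{II}h(x,y,z)=\{h(x),y,z\}-\{h(y),x,z\}+\{x,y,h(z)\}-h(\{x,y,z\})$. For $(f,g)\in C^2(L,L)\times C^3(L,L)$, $\delta(f,g)=(\delta_If,\delta_{II}g)$, where $(\delta_If)(x_1,\dots,x_4)=[x_3,g(x_1,x_2,x_4)]-[x_4,g(x_1,x_2,x_3)]-g(x_1,x_2,[x_3,x_4])-\{x_1,x_2,f(x_3,x_4)\}+f(\{x_1,x_2,x_3\},x_4)+f(x_3,\{x_1,x_2,x_4\})$ (this depends on both $f$ and $g$), $(\delta_{II}g)(x_1,\dots,x_5)=\{g(x_1,x_2,x_3),x_4,x_5\}-\{g(x_1,x_2,x_4),x_3,x_5\}-\{x_1,x_2,g(x_3,x_4,x_5)\}+\{x_3,x_4,g(x_1,x_2,x_5)\}+g(\{x_1,x_2,x_3\},x_4,x_5)+g(x_3,\{x_1,x_2,x_4\},x_5)+g(x_3,x_4,\{x_1,x_2,x_5\})-g(x_1,x_2,\{x_3,x_4,x_5\})$.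 Set $Z_G^2(L,L)\times Z_G^3(L,L):=\{(f,g)\in C_G^2(L,L)\times C_G^3(L,L):\delta(f,g)=(0,0)\}$, $B_G^2(L,L)\times B_G^3(L,L):=\{(\delta^1_Ih,\delta^1_{II}h):h\in C_G^1(L,L)\}$, and $H_G^2(L,L)\times H_G^3(L,L):=(Z_G^2(L,L)\times Z_G^3(L,L))/(B_G^2(L,L)\times B_G^3(L,L))$. The product symbols here are notation for a single subspace of $C_G^2\times C_G^3$ and a single quotient space. *)

theory Defs
  imports
    "HOL-Algebra.Group"
    "HOL-Computational_Algebra.Polynomial"
    "HOL-Computational_Algebra.Formal_Power_Series"
begin

section \<open>Lie-Yamaguti algebras\<close>

definition bilinear_map :: "('r::comm_ring_1 \<Rightarrow> 'a::ab_group_add \<Rightarrow> 'a) \<Rightarrow> ('a \<Rightarrow> 'a \<Rightarrow> 'a) \<Rightarrow> bool" where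
  "bilinear_map s f \<longleftrightarrow>
     (\<forall>y. module_hom s s (\<lambda>x. f x y)) \<and>
     (\<forall>x. module_hom s s (\<lambda>y. f x y))"

definition trilinear_map :: "('r::comm_ring_1 \<Rightarrow> 'a::ab_group_add \<Rightarrow> 'a) \<Rightarrow> ('a \<Rightarrow> 'a \<Rightarrow> 'a \<Rightarrow> 'a) \<Rightarrow> bool" where
  "trilinear_map s g \<longleftrightarrow>
     (\<forall>y z. module_hom s s (\<lambda>x. g x y z)) \<and>
     (\<forall>x z. module_hom s s (\<lambda>y. g x y z)) \<and>
     (\<forall>x y. module_hom s s (\<lambda>z. g x y z))"

text \<open>Stated over an arbitrary commutative ring, so that the same definition applies over a
  field and over its ring of formal power series. Over a field, the locale \<open>module\<close> is the
  notion of a vector space.\<close>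

locale lie_yamaguti = module scale
  for scale :: "'r::comm_ring_1 \<Rightarrow> 'a::ab_group_add \<Rightarrow> 'a" +
  fixes br :: "'a \<Rightarrow> 'a \<Rightarrow> 'a"
    and tr :: "'a \<Rightarrow> 'a \<Rightarrow> 'a \<Rightarrow> 'a"
  assumes br_bilinear: "bilinear_map scale br"
    and tr_trilinear: "trilinear_map scale tr"
    and LY1: "br x y = - br y x"
    and LY2: "tr x y z = - tr y x z"
    and LY3: "(br (br x y) z + tr x y z) + (br (br y z) x + tr y z x) + (br (br z x) y + tr z x y) = 0"
    and LY4: "tr (br x y) z u + tr (br y z) x u + tr (br z x) y u = 0"
    and LY5: "tr x y (br u v) = br (tr x y u) v + br u (tr x y v)"
    and LY6: "tr x y (tr u v w) = tr (tr x y u) v w + tr u (tr x y v) w + tr u v (tr x y w)"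


section \<open>Finite group actions\<close>

locale lie_yamaguti_action =
  lie_yamaguti scale br tr + group G
  for scale :: "'r::comm_ring_1 \<Rightarrow> 'a::ab_group_add \<Rightarrow> 'a"
    and br :: "'a \<Rightarrow> 'a \<Rightarrow> 'a"
    and tr :: "'a \<Rightarrow> 'a \<Rightarrow> 'a \<Rightarrow> 'a"
    and G :: "('g, 'm) monoid_scheme" (structure) +
  fixes act :: "'g \<Rightarrow> 'a \<Rightarrow> 'a"
  assumes finite_group: "finite (carrier G)"
    and act_linear: "\<sigma> \<in> carrier G \<Longrightarrow> module_hom scale scale (act \<sigma>)"
    and act_one: "act \<one> a = a"
    and act_mult: "\<sigma> \<in> carrier G \<Longrightarrow> \<tau> \<in> carrier G \<Longrightarrow> act \<sigma> (act \<tau> a) = act (\<sigma> \<otimes> \<tau>) a"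
    and act_br: "\<sigma> \<in> carrier G \<Longrightarrow> act \<sigma> (br a b) = br (act \<sigma> a) (act \<sigma> b)"
    and act_tr: "\<sigma> \<in> carrier G \<Longrightarrow> act \<sigma> (tr a b c) = tr (act \<sigma> a) (act \<sigma> b) (act \<sigma> c)"

definition equivariant1 :: "('g, 'm) monoid_scheme \<Rightarrow> ('g \<Rightarrow> 'a \<Rightarrow> 'a) \<Rightarrow> ('a \<Rightarrow> 'a) \<Rightarrow> bool" where
  "equivariant1 G act h \<longleftrightarrow> (\<forall>\<sigma>\<in>carrier G. \<forall>x. h (act \<sigma> x) = act \<sigma> (h x))"

definition equivariant2 :: "('g, 'm) monoid_scheme \<Rightarrow> ('g \<Rightarrow> 'a \<Rightarrow> 'a) \<Rightarrow> ('a \<Rightarrow> 'a \<Rightarrow> 'a) \<Rightarrow> bool" where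
  "equivariant2 G act f \<longleftrightarrow>
     (\<forall>\<sigma>\<in>carrier G. \<forall>x y. f (act \<sigma> x) (act \<sigma> y) = act \<sigma> (f x y))"

definition equivariant3 :: "('g, 'm) monoid_scheme \<Rightarrow> ('g \<Rightarrow> 'a \<Rightarrow> 'a) \<Rightarrow> ('a \<Rightarrow> 'a \<Rightarrow> 'a \<Rightarrow> 'a) \<Rightarrow> bool" where
  "equivariant3 G act g \<longleftrightarrow>
     (\<forall>\<sigma>\<in>carrier G. \<forall>x y z. g (act \<sigma> x) (act \<sigma> y) (act \<sigma> z) = act \<sigma> (g x y z))"


section \<open>Formal power series with coefficients in the algebra\<close>

text \<open>\<open>L[[t]]\<close> is the type \<^typ>\<open>'a fps\<close>, which is an abelian group for any abelian
  group \<^typ>\<open>'a\<close>; its module structure over \<open>K[[t]]\<close> is the Cauchy product.\<close>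

definition fps_scale :: "('k::comm_ring_1 \<Rightarrow> 'a::ab_group_add \<Rightarrow> 'a) \<Rightarrow> 'k fps \<Rightarrow> 'a fps \<Rightarrow> 'a fps" where
  "fps_scale s c x = Abs_fps (\<lambda>n. \<Sum>i\<le>n. s (fps_nth c i) (fps_nth x (n - i)))"

text \<open>For coefficient maps that are multilinear over \<open>K\<close>, the following are the maps on
  \<open>L[[t]]\<close> obtained by \<open>K[[t]]\<close>-multilinear extension: the coefficient of \<open>t^n\<close> is the sum over
  all ways to write \<open>n\<close> as \<open>i + a\<close>, \<open>i + a + b\<close>, or \<open>i + a + b + c\<close>, where \<open>i\<close> is the index of the
  coefficient map and \<open>a\<close>, \<open>b\<close>, \<open>c\<close> are the degrees in the arguments.\<close>

definition fps_ext1 :: "(nat \<Rightarrow> 'a \<Rightarrow> 'a) \<Rightarrow> 'a::ab_group_add fps \<Rightarrow> 'a fps" where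
  "fps_ext1 h x = Abs_fps (\<lambda>n. \<Sum>i\<le>n. h i (fps_nth x (n - i)))"

definition fps_ext2 :: "(nat \<Rightarrow> 'a \<Rightarrow> 'a \<Rightarrow> 'a) \<Rightarrow> 'a::ab_group_add fps \<Rightarrow> 'a fps \<Rightarrow> 'a fps" where
  "fps_ext2 f x y = Abs_fps (\<lambda>n. \<Sum>i\<le>n. \<Sum>a\<le>n - i. f i (fps_nth x a) (fps_nth y (n - i - a)))"

definition fps_ext3 :: "(nat \<Rightarrow> 'a \<Rightarrow> 'a \<Rightarrow> 'a \<Rightarrow> 'a) \<Rightarrow> 'a::ab_group_add fps \<Rightarrow> 'a fps \<Rightarrow> 'a fps \<Rightarrow> 'a fps" where
  "fps_ext3 g x y z = Abs_fps (\<lambda>n. \<Sum>i\<le>n. \<Sum>a\<le>n - i. \<Sum>b\<le>n - i - a.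
     g i (fps_nth x a) (fps_nth y b) (fps_nth z (n - i - a - b)))"

lemma module_fps_scale:
  assumes "module s"
  shows "module (fps_scale s)"
proof -
  interpret module s by fact
  show ?thesis
  proof
    fix a b :: "'a fps" and x y :: "'b fps"
    show "fps_scale s a (x + y) = fps_scale s a x + fps_scale s a y"
      by (rule fps_ext) (simp add: fps_scale_def scale_right_distrib sum.distrib)
    show "fps_scale s (a + b) x = fps_scale s a x + fps_scale s b x"
      by (rule fps_ext) (simp add: fps_scale_def scale_left_distrib sum.distrib)
    show "fps_scale s 1 x = x"
    proof (rule fps_ext)
      fix n
      have "(\<Sum>i\<le>n. s (fps_nth 1 i) (fps_nth x (n - i)))
          = (\<Sum>i\<le>n. if i = 0 then fps_nth x (n - i) else 0)"
        by (intro sum.cong) auto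
      then show "fps_nth (fps_scale s 1 x) n = fps_nth x n"
        by (simp add: fps_scale_def)
    qed
    show "fps_scale s a (fps_scale s b x) = fps_scale s (a * b) x"
    proof (rule fps_ext)
      fix n
      let ?F = "\<lambda>i j k. s (fps_nth a i) (s (fps_nth b j) (fps_nth x k))"
      have "(\<Sum>i\<le>n. \<Sum>j\<le>n - i. ?F i j (n - i - j)) =
            (\<Sum>k\<le>n. \<Sum>i\<le>k. ?F i (k - i) (n - k))"
        using sum.triangle_reindex_eq[where n = n and g = "\<lambda>i j. ?F i j (n - i - j)"]
        by (simp add: sum.Sigma)
           (auto simp: sum.Sigma intro!: sum.reindex_bij_witness
              [where i = "\<lambda>(k, i). (i, k - i)" and j = "\<lambda>(i, j). (i + j, i)"])
      then show "fps_nth (fps_scale s a (fps_scale s b x)) n = fps_nth (fps_scale s (a * b) x) n"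
        by (simp add: fps_scale_def fps_mult_nth scale_sum_right scale_sum_left atLeast0AtMost)
    qed
  qed
qed


section \<open>Equivariant formal deformations\<close>

text \<open>The series \<open>f\<^sub>t\<close> and \<open>g\<^sub>t\<close> are represented by their sequences of coefficient maps.
  Equivariance of \<open>f 0\<close> and \<open>g 0\<close> is part of the group action.\<close>

definition equivariant_deformation ::
  "('k::field \<Rightarrow> 'a::ab_group_add \<Rightarrow> 'a) \<Rightarrow> ('a \<Rightarrow> 'a \<Rightarrow> 'a) \<Rightarrow> ('a \<Rightarrow> 'a \<Rightarrow> 'a \<Rightarrow> 'a) \<Rightarrow>
   ('g, 'm) monoid_scheme \<Rightarrow> ('g \<Rightarrow> 'a \<Rightarrow> 'a) \<Rightarrow>
   (nat \<Rightarrow> 'a \<Rightarrow> 'a \<Rightarrow> 'a) \<Rightarrow> (nat \<Rightarrow> 'a \<Rightarrow> 'a \<Rightarrow> 'a \<Rightarrow> 'a) \<Rightarrow> bool" where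
  "equivariant_deformation s br tr G act f g \<longleftrightarrow>
     f 0 = br \<and> g 0 = tr \<and>
     (\<forall>i. bilinear_map s (f i)) \<and> (\<forall>i. trilinear_map s (g i)) \<and>
     lie_yamaguti (fps_scale s) (fps_ext2 f) (fps_ext3 g) \<and>
     (\<forall>i\<ge>1. equivariant2 G act (f i)) \<and> (\<forall>i\<ge>1. equivariant3 G act (g i))"

definition equivalent_deformations ::
  "('k::field \<Rightarrow> 'a::ab_group_add \<Rightarrow> 'a) \<Rightarrow> ('g, 'm) monoid_scheme \<Rightarrow> ('g \<Rightarrow> 'a \<Rightarrow> 'a) \<Rightarrow>
   (nat \<Rightarrow> 'a \<Rightarrow> 'a \<Rightarrow> 'a) \<Rightarrow> (nat \<Rightarrow> 'a \<Rightarrow> 'a \<Rightarrow> 'a \<Rightarrow> 'a) \<Rightarrow>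
   (nat \<Rightarrow> 'a \<Rightarrow> 'a \<Rightarrow> 'a) \<Rightarrow> (nat \<Rightarrow> 'a \<Rightarrow> 'a \<Rightarrow> 'a \<Rightarrow> 'a) \<Rightarrow> bool" where
  "equivalent_deformations s G act f g f' g' \<longleftrightarrow>
     (\<exists>\<phi> :: nat \<Rightarrow> 'a \<Rightarrow> 'a.
        (\<forall>i. module_hom s s (\<phi> i)) \<and> \<phi> 0 = id \<and> (\<forall>i. equivariant1 G act (\<phi> i)) \<and>
        module_hom (fps_scale s) (fps_scale s) (fps_ext1 \<phi>) \<and> bij (fps_ext1 \<phi>) \<and>
        (\<forall>x y. fps_ext1 \<phi> (fps_ext2 f x y) = fps_ext2 f' (fps_ext1 \<phi> x) (fps_ext1 \<phi> y)) \<and>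
        (\<forall>x y z. fps_ext1 \<phi> (fps_ext3 g x y z) =
           fps_ext3 g' (fps_ext1 \<phi> x) (fps_ext1 \<phi> y) (fps_ext1 \<phi> z)))"


section \<open>Equivariant cohomology with adjoint coefficients\<close>

text \<open>The equivariant cochain spaces in degrees 1, 2 and 3, with cochains in curried form. The
  vanishing condition on the arguments \<open>2i - 1\<close> and \<open>2i\<close> is void in degree 1 and concerns only
  the first two arguments in degrees 2 and 3.\<close>

definition cochains1 ::
  "('k::field \<Rightarrow> 'a::ab_group_add \<Rightarrow> 'a) \<Rightarrow> ('g, 'm) monoid_scheme \<Rightarrow> ('g \<Rightarrow> 'a \<Rightarrow> 'a) \<Rightarrow> ('a \<Rightarrow> 'a) set" where
  "cochains1 s G act = {h. module_hom s s h \<and> equivariant1 G act h}"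

definition cochains2 ::
  "('k::field \<Rightarrow> 'a::ab_group_add \<Rightarrow> 'a) \<Rightarrow> ('g, 'm) monoid_scheme \<Rightarrow> ('g \<Rightarrow> 'a \<Rightarrow> 'a) \<Rightarrow>
   ('a \<Rightarrow> 'a \<Rightarrow> 'a) set" where
  "cochains2 s G act = {f. bilinear_map s f \<and> (\<forall>x. f x x = 0) \<and> equivariant2 G act f}"

definition cochains3 ::
  "('k::field \<Rightarrow> 'a::ab_group_add \<Rightarrow> 'a) \<Rightarrow> ('g, 'm) monoid_scheme \<Rightarrow> ('g \<Rightarrow> 'a \<Rightarrow> 'a) \<Rightarrow>
   ('a \<Rightarrow> 'a \<Rightarrow> 'a \<Rightarrow> 'a) set" where
  "cochains3 s G act = {g. trilinear_map s g \<and> (\<forall>x z. g x x z = 0) \<and> equivariant3 G act g}"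

definition delta1_I ::
  "('a::ab_group_add \<Rightarrow> 'a \<Rightarrow> 'a) \<Rightarrow> ('a \<Rightarrow> 'a) \<Rightarrow> 'a \<Rightarrow> 'a \<Rightarrow> 'a" where
  "delta1_I br h x y = br x (h y) - br y (h x) - h (br x y)"

definition delta1_II ::
  "('a::ab_group_add \<Rightarrow> 'a \<Rightarrow> 'a \<Rightarrow> 'a) \<Rightarrow> ('a \<Rightarrow> 'a) \<Rightarrow> 'a \<Rightarrow> 'a \<Rightarrow> 'a \<Rightarrow> 'a" where
  "delta1_II tr h x y z = tr (h x) y z - tr (h y) x z + tr x y (h z) - h (tr x y z)"

definition delta_I ::
  "('a::ab_group_add \<Rightarrow> 'a \<Rightarrow> 'a) \<Rightarrow> ('a \<Rightarrow> 'a \<Rightarrow> 'a \<Rightarrow> 'a) \<Rightarrow>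
   ('a \<Rightarrow> 'a \<Rightarrow> 'a) \<Rightarrow> ('a \<Rightarrow> 'a \<Rightarrow> 'a \<Rightarrow> 'a) \<Rightarrow> 'a \<Rightarrow> 'a \<Rightarrow> 'a \<Rightarrow> 'a \<Rightarrow> 'a" where
  "delta_I br tr f g x1 x2 x3 x4 =
     br x3 (g x1 x2 x4) - br x4 (g x1 x2 x3) - g x1 x2 (br x3 x4)
     - tr x1 x2 (f x3 x4) + f (tr x1 x2 x3) x4 + f x3 (tr x1 x2 x4)"

definition delta_II ::
  "('a::ab_group_add \<Rightarrow> 'a \<Rightarrow> 'a \<Rightarrow> 'a) \<Rightarrow> ('a \<Rightarrow> 'a \<Rightarrow> 'a \<Rightarrow> 'a) \<Rightarrow>
   'a \<Rightarrow> 'a \<Rightarrow> 'a \<Rightarrow> 'a \<Rightarrow> 'a \<Rightarrow> 'a" where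
  "delta_II tr g x1 x2 x3 x4 x5 =
     tr (g x1 x2 x3) x4 x5 - tr (g x1 x2 x4) x3 x5 - tr x1 x2 (g x3 x4 x5)
     + tr x3 x4 (g x1 x2 x5) + g (tr x1 x2 x3) x4 x5 + g x3 (tr x1 x2 x4) x5
     + g x3 x4 (tr x1 x2 x5) - g x1 x2 (tr x3 x4 x5)"

definition cocycles ::
  "('k::field \<Rightarrow> 'a::ab_group_add \<Rightarrow> 'a) \<Rightarrow> ('a \<Rightarrow> 'a \<Rightarrow> 'a) \<Rightarrow> ('a \<Rightarrow> 'a \<Rightarrow> 'a \<Rightarrow> 'a) \<Rightarrow>
   ('g, 'm) monoid_scheme \<Rightarrow> ('g \<Rightarrow> 'a \<Rightarrow> 'a) \<Rightarrow>
   (('a \<Rightarrow> 'a \<Rightarrow> 'a) \<times> ('a \<Rightarrow> 'a \<Rightarrow> 'a \<Rightarrow> 'a)) set" where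
  "cocycles s br tr G act =
     {(f, g). f \<in> cochains2 s G act \<and> g \<in> cochains3 s G act \<and>
        (\<forall>x1 x2 x3 x4. delta_I br tr f g x1 x2 x3 x4 = 0) \<and>
        (\<forall>x1 x2 x3 x4 x5. delta_II tr g x1 x2 x3 x4 x5 = 0)}"

definition coboundaries ::
  "('k::field \<Rightarrow> 'a::ab_group_add \<Rightarrow> 'a) \<Rightarrow> ('a \<Rightarrow> 'a \<Rightarrow> 'a) \<Rightarrow> ('a \<Rightarrow> 'a \<Rightarrow> 'a \<Rightarrow> 'a) \<Rightarrow>
   ('g, 'm) monoid_scheme \<Rightarrow> ('g \<Rightarrow> 'a \<Rightarrow> 'a) \<Rightarrow>
   (('a \<Rightarrow> 'a \<Rightarrow> 'a) \<times> ('a \<Rightarrow> 'a \<Rightarrow> 'a \<Rightarrow> 'a)) set" where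
  "coboundaries s br tr G act = {(delta1_I br h, delta1_II tr h) | h. h \<in> cochains1 s G act}"

definition cohomologous ::
  "('k::field \<Rightarrow> 'a::ab_group_add \<Rightarrow> 'a) \<Rightarrow> ('a \<Rightarrow> 'a \<Rightarrow> 'a) \<Rightarrow> ('a \<Rightarrow> 'a \<Rightarrow> 'a \<Rightarrow> 'a) \<Rightarrow>
   ('g, 'm) monoid_scheme \<Rightarrow> ('g \<Rightarrow> 'a \<Rightarrow> 'a) \<Rightarrow>
   ((('a \<Rightarrow> 'a \<Rightarrow> 'a) \<times> ('a \<Rightarrow> 'a \<Rightarrow> 'a \<Rightarrow> 'a)) \<times> (('a \<Rightarrow> 'a \<Rightarrow> 'a) \<times> ('a \<Rightarrow> 'a \<Rightarrow> 'a \<Rightarrow> 'a))) set" where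
  "cohomologous s br tr G act =
     {((f, g), (f', g')). (f, g) \<in> cocycles s br tr G act \<and> (f', g') \<in> cocycles s br tr G act \<and>
        ((\<lambda>x y. f x y - f' x y), (\<lambda>x y z. g x y z - g' x y z)) \<in> coboundaries s br tr G act}"

lemma equiv_cohomologous:
  assumes "lie_yamaguti_action s br tr G act"
  shows "equiv (cocycles s br tr G act) (cohomologous s br tr G act)"
proof -
  interpret lie_yamaguti_action s br tr G act by fact
  let ?B = "coboundaries s br tr G act"
  have br_hom: "module_hom s s (\<lambda>y. br x y)" for x
    using br_bilinear by (simp add: bilinear_map_def)
  have tr_hom: "module_hom s s (\<lambda>x. tr x y z)" "module_hom s s (\<lambda>z. tr x y z)" for x y z
    using tr_trilinear by (simp_all add: trilinear_map_def)
  note diffs = module_hom.diff[OF br_hom] module_hom.diff[OF tr_hom(1)] module_hom.diff[OF tr_hom(2)]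
  note zeros = module_hom.zero[OF br_hom] module_hom.zero[OF tr_hom(1)] module_hom.zero[OF tr_hom(2)]
  have zero: "((\<lambda>x y. 0), (\<lambda>x y z. 0)) \<in> ?B"
  proof -
    have "module_hom s s (\<lambda>_. 0)"
      by unfold_locales auto
    then have "(\<lambda>_. 0) \<in> cochains1 s G act"
      using module_hom.zero[OF act_linear] by (auto simp: cochains1_def equivariant1_def)
    moreover have "delta1_I br (\<lambda>_. 0) = (\<lambda>x y. 0)" "delta1_II tr (\<lambda>_. 0) = (\<lambda>x y z. 0)"
      by (simp_all add: fun_eq_iff delta1_I_def delta1_II_def zeros)
    ultimately show ?thesis
      unfolding coboundaries_def by (auto intro!: exI[of _ "\<lambda>_. 0"])
  qed
  have diff: "((\<lambda>x y. f x y - f' x y), (\<lambda>x y z. g x y z - g' x y z)) \<in> ?B"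
    if "(f, g) \<in> ?B" "(f', g') \<in> ?B" for f g f' g'
  proof -
    obtain h h' where h: "h \<in> cochains1 s G act" "h' \<in> cochains1 s G act"
      and eq: "f = delta1_I br h" "g = delta1_II tr h" "f' = delta1_I br h'" "g' = delta1_II tr h'"
      using \<open>(f, g) \<in> ?B\<close> \<open>(f', g') \<in> ?B\<close> unfolding coboundaries_def by auto
    interpret module_pair s s ..
    have "(\<lambda>x. h x - h' x) \<in> cochains1 s G act"
      using h module_hom_sub[of h h']
      by (auto simp: cochains1_def equivariant1_def module_hom.diff[OF act_linear])
    moreover have "(\<lambda>x y. f x y - f' x y) = delta1_I br (\<lambda>x. h x - h' x)"
      "(\<lambda>x y z. g x y z - g' x y z) = delta1_II tr (\<lambda>x. h x - h' x)"
      by (simp_all add: fun_eq_iff eq delta1_I_def delta1_II_def diffs)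
    ultimately show ?thesis
      unfolding coboundaries_def by blast
  qed
  show ?thesis
  proof (rule equivI)
    show "cohomologous s br tr G act \<subseteq> cocycles s br tr G act \<times> cocycles s br tr G act"
      by (auto simp: cohomologous_def)
    show "refl_on (cocycles s br tr G act) (cohomologous s br tr G act)"
      using zero by (auto simp: cohomologous_def refl_on_def)
    show "sym (cohomologous s br tr G act)"
      using diff[OF zero] by (fastforce simp: cohomologous_def intro!: symI)
    show "trans (cohomologous s br tr G act)"
    proof (rule transI, clarsimp simp: cohomologous_def)
      fix f g f' g' f'' g''
      assume 1: "((\<lambda>x y. f x y - f' x y), (\<lambda>x y z. g x y z - g' x y z)) \<in> ?B"
        and 2: "((\<lambda>x y. f' x y - f'' x y), (\<lambda>x y z. g' x y z - g'' x y z)) \<in> ?B"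
      show "((\<lambda>x y. f x y - f'' x y), (\<lambda>x y z. g x y z - g'' x y z)) \<in> ?B"
        using diff[OF 1 diff[OF zero 2]] by simp
    qed
  qed
qed

text \<open>The single quotient space denoted \<open>H_G^2 \<times> H_G^3\<close>; its elements are the cohomology
  classes, as sets of cocycle pairs.\<close>

definition cohomology ::
  "('k::field \<Rightarrow> 'a::ab_group_add \<Rightarrow> 'a) \<Rightarrow> ('a \<Rightarrow> 'a \<Rightarrow> 'a) \<Rightarrow> ('a \<Rightarrow> 'a \<Rightarrow> 'a \<Rightarrow> 'a) \<Rightarrow>
   ('g, 'm) monoid_scheme \<Rightarrow> ('g \<Rightarrow> 'a \<Rightarrow> 'a) \<Rightarrow>
   (('a \<Rightarrow> 'a \<Rightarrow> 'a) \<times> ('a \<Rightarrow> 'a \<Rightarrow> 'a \<Rightarrow> 'a)) set set" where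
  "cohomology s br tr G act = cocycles s br tr G act // cohomologous s br tr G act"

end

theory Submission
  imports Defs
begin

text \<open>Evaluate all identities on constant series and compare coefficients of \<open>t\<close>. For (LY1) and
  (LY2) this shows that \<open>f\<^sub>1\<close> and \<open>g\<^sub>1\<close> are alternating in the first two arguments, since the
  characteristic is not 2; for (LY5) and (LY6) it gives the two cocycle equations. For an
  equivalence \<open>\<phi>\<^sub>t\<close> it gives \<open>(f\<^sub>1, g\<^sub>1) - (f'\<^sub>1, g'\<^sub>1) = \<delta> \<phi>\<^sub>1\<close>.\<close>

lemma fps_ext1_nth_0: "fps_nth (fps_ext1 h x) 0 = h 0 (fps_nth x 0)"
  by (simp add: fps_ext1_def)

lemma fps_ext1_nth_1: "fps_nth (fps_ext1 h x) (Suc 0) = h 0 (fps_nth x 1) + h 1 (fps_nth x 0)"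
  by (simp add: fps_ext1_def)

lemma fps_ext2_nth_0: "fps_nth (fps_ext2 f x y) 0 = f 0 (fps_nth x 0) (fps_nth y 0)"
  by (simp add: fps_ext2_def)

text \<open>The total degree 1 falls either on one argument or on the index of the coefficient map,
  so this is a Leibniz rule plus a correction term in \<open>f 1\<close>.\<close>

lemma fps_ext2_nth_1:
  "fps_nth (fps_ext2 f x y) (Suc 0) =
     f 0 (fps_nth x 0) (fps_nth y 1) + f 0 (fps_nth x 1) (fps_nth y 0)
     + f 1 (fps_nth x 0) (fps_nth y 0)"
  by (simp add: fps_ext2_def)

lemma fps_ext3_nth_0:
  "fps_nth (fps_ext3 g x y z) 0 = g 0 (fps_nth x 0) (fps_nth y 0) (fps_nth z 0)"
  by (simp add: fps_ext3_def)

lemma fps_ext3_nth_1: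
  "fps_nth (fps_ext3 g x y z) (Suc 0) =
     g 0 (fps_nth x 0) (fps_nth y 0) (fps_nth z 1) + g 0 (fps_nth x 0) (fps_nth y 1) (fps_nth z 0)
     + g 0 (fps_nth x 1) (fps_nth y 0) (fps_nth z 0) + g 1 (fps_nth x 0) (fps_nth y 0) (fps_nth z 0)"
  by (simp add: fps_ext3_def)

lemmas fps_ext_nths =
  fps_ext1_nth_0 fps_ext1_nth_1 fps_ext2_nth_0 fps_ext2_nth_1 fps_ext3_nth_0 fps_ext3_nth_1

text \<open>A constant series has zero coefficient at t, so these zeros kill every order-t term in
  which an undeformed operation meets the degree-1 part of a constant argument.\<close>

lemma bilinear_map_zero:
  assumes "bilinear_map s f"
  shows "f 0 y = 0" "f x 0 = 0"
  using assms module_hom.zero[of s s "\<lambda>x. f x y"] module_hom.zero[of s s "f x"]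
  by (simp_all add: bilinear_map_def)

lemma trilinear_map_zero:
  assumes "trilinear_map s g"
  shows "g 0 y z = 0" "g x 0 z = 0" "g x y 0 = 0"
  using assms module_hom.zero[of s s "\<lambda>x. g x y z"] module_hom.zero[of s s "\<lambda>y. g x y z"]
    module_hom.zero[of s s "g x y"]
  by (simp_all add: trilinear_map_def)

text \<open>Doubling \<open>x\<close> gives 0, and 2 is invertible in the field. This upgrades
  skew-symmetry to the vanishing on equal arguments that cochains require.\<close>

lemma eq_neg_self_imp_zero:
  fixes s :: "'k::field \<Rightarrow> 'a::ab_group_add \<Rightarrow> 'a" and x :: 'a
  assumes "module s" and "CHAR('k) \<noteq> 2" and "x = - x"
  shows "x = 0"
proof -
  interpret module s by fact
  \<comment> \<open>The only divisors of the prime 2 are 1 and 2, and a field never has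
    characteristic 1.\<close>
  have "CHAR('k) dvd 2 \<Longrightarrow> CHAR('k) = 2"
    using prime_nat_iff[of 2] CHAR_not_1'[where 'a = 'k] by auto
  then have two: "(2::'k) \<noteq> 0"
    using assms(2) of_nat_eq_0_iff_char_dvd[of 2, where 'a = 'k] by auto
  have "s 2 x = x + x"
    using scale_left_distrib[of 1 1 x] by simp
  also have "\<dots> = 0"
    using assms(3) by (metis add.right_inverse)
  finally have "s (inverse 2) (s 2 x) = 0"
    by simp
  then show ?thesis
    using two by simp
qed

text \<open>Linearising LY5 involves both \<open>f 1\<close> and \<open>g 1\<close>, while LY6
  involves only \<open>g 1\<close>; this matches \<open>delta_I\<close> and \<open>delta_II\<close>.
  Multilinearity and equivariance come from the definition of a deformation.\<close>

lemma deformation_infinitesimal_cocycle: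
  fixes s :: "'k::field \<Rightarrow> 'a::ab_group_add \<Rightarrow> 'a"
  assumes char: "CHAR('k) \<noteq> 2"
    and L: "lie_yamaguti s br tr"
    and D: "equivariant_deformation s br tr G act f g"
  shows "(f 1, g 1) \<in> cocycles s br tr G act"
proof -
  interpret L: lie_yamaguti s br tr by fact
  interpret D: lie_yamaguti "fps_scale s" "fps_ext2 f" "fps_ext3 g"
    using D by (simp add: equivariant_deformation_def)
  have f0: "f 0 = br" and g0: "g 0 = tr"
    and f1: "bilinear_map s (f 1)" and g1: "trilinear_map s (g 1)"
    and eqv: "equivariant2 G act (f 1)" "equivariant3 G act (g 1)"
    using D by (simp_all add: equivariant_deformation_def)
  note simps = fps_ext_nths f0 g0
    bilinear_map_zero[OF L.br_bilinear] trilinear_map_zero[OF L.tr_trilinear]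
  have "f 1 x x = - f 1 x x" for x
    using arg_cong[OF D.LY1[of "fps_const x" "fps_const x"], of "\<lambda>u. fps_nth u 1"]
    by (simp add: simps)
  then have alt_f: "f 1 x x = 0" for x
    by (rule eq_neg_self_imp_zero[OF L.module_axioms char])
  have "g 1 x x z = - g 1 x x z" for x z
    using arg_cong[OF D.LY2[of "fps_const x" "fps_const x" "fps_const z"], of "\<lambda>u. fps_nth u 1"]
    by (simp add: simps)
  then have alt_g: "g 1 x x z = 0" for x z
    by (rule eq_neg_self_imp_zero[OF L.module_axioms char])
  \<comment> \<open>At order t, \<open>delta_I\<close> is the right side of LY5 minus its left side,
    once \<open>L.LY1\<close> moves \<open>g 1 x y u\<close> to the second slot of the
    bracket.\<close>
  have "delta_I br tr (f 1) (g 1) x y u v = 0" for x y u v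
    using arg_cong[OF D.LY5[of "fps_const x" "fps_const y" "fps_const u" "fps_const v"],
        of "\<lambda>u. fps_nth u 1"] L.LY1[of v "g 1 x y u"]
    by (simp add: simps delta_I_def algebra_simps)
  \<comment> \<open>Likewise for LY6, where \<open>L.LY2\<close> accounts for the minus sign in the
    second term of \<open>delta_II\<close>.\<close>
  moreover have "delta_II tr (g 1) x y u v w = 0" for x y u v w
    using arg_cong[OF D.LY6[of "fps_const x" "fps_const y" "fps_const u" "fps_const v" "fps_const w"],
        of "\<lambda>u. fps_nth u 1"] L.LY2[of "g 1 x y v" u w]
    by (simp add: simps delta_II_def algebra_simps)
  ultimately show ?thesis
    using f1 g1 eqv alt_f alt_g by (simp add: cocycles_def cochains2_def cochains3_def)
qed

text \<open>Since \<open>\<phi> 0\<close> is the identity, at order t the difference is the failure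
  of \<open>\<phi> 1\<close> to be a derivation of the two undeformed operations, which is its
  coboundary.\<close>

lemma equivalent_deformations_infinitesimal_diff:
  assumes L: "lie_yamaguti s br tr"
    and D: "equivariant_deformation s br tr G act f g"
    and D': "equivariant_deformation s br tr G act f' g'"
    and E: "equivalent_deformations s G act f g f' g'"
  shows "((\<lambda>x y. f 1 x y - f' 1 x y), (\<lambda>x y z. g 1 x y z - g' 1 x y z))
           \<in> coboundaries s br tr G act"
proof -
  interpret L: lie_yamaguti s br tr by fact
  have 0: "f 0 = br" "g 0 = tr" "f' 0 = br" "g' 0 = tr"
    using D D' by (simp_all add: equivariant_deformation_def)
  obtain \<phi> where \<phi>0: "\<phi> 0 = id" and hom: "\<And>i. module_hom s s (\<phi> i)"
    and eqv: "\<And>i. equivariant1 G act (\<phi> i)"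
    and \<phi>f: "\<And>x y. fps_ext1 \<phi> (fps_ext2 f x y) = fps_ext2 f' (fps_ext1 \<phi> x) (fps_ext1 \<phi> y)"
    and \<phi>g: "\<And>x y z. fps_ext1 \<phi> (fps_ext3 g x y z) =
      fps_ext3 g' (fps_ext1 \<phi> x) (fps_ext1 \<phi> y) (fps_ext1 \<phi> z)"
    using E unfolding equivalent_deformations_def by blast
  note simps = fps_ext_nths 0 \<phi>0
    bilinear_map_zero[OF L.br_bilinear] trilinear_map_zero[OF L.tr_trilinear]
  have "f 1 x y - f' 1 x y = delta1_I br (\<phi> 1) x y" for x y
    using arg_cong[OF \<phi>f[of "fps_const x" "fps_const y"], of "\<lambda>u. fps_nth u 1"]
      L.LY1[of y "\<phi> 1 x"]
    by (simp add: simps delta1_I_def algebra_simps)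
  moreover have "g 1 x y z - g' 1 x y z = delta1_II tr (\<phi> 1) x y z" for x y z
    using arg_cong[OF \<phi>g[of "fps_const x" "fps_const y" "fps_const z"], of "\<lambda>u. fps_nth u 1"]
      L.LY2[of "\<phi> 1 y" x z]
    by (simp add: simps delta1_II_def algebra_simps)
  ultimately have "(\<lambda>x y. f 1 x y - f' 1 x y) = delta1_I br (\<phi> 1)"
    "(\<lambda>x y z. g 1 x y z - g' 1 x y z) = delta1_II tr (\<phi> 1)"
    by (simp_all add: fun_eq_iff)
  moreover have "\<phi> 1 \<in> cochains1 s G act"
    using hom eqv by (simp add: cochains1_def)
  ultimately show ?thesis
    unfolding coboundaries_def by blast
qed

theorem theorem5p5:
  fixes scale :: "'k::alg_closed_field \<Rightarrow> 'a::ab_group_add \<Rightarrow> 'a"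
    and br :: "'a \<Rightarrow> 'a \<Rightarrow> 'a" and tr :: "'a \<Rightarrow> 'a \<Rightarrow> 'a \<Rightarrow> 'a"
    and G :: "('g, 'm) monoid_scheme" and act :: "'g \<Rightarrow> 'a \<Rightarrow> 'a"
    and f f' :: "nat \<Rightarrow> 'a \<Rightarrow> 'a \<Rightarrow> 'a" and g g' :: "nat \<Rightarrow> 'a \<Rightarrow> 'a \<Rightarrow> 'a \<Rightarrow> 'a"
  assumes "CHAR('k) \<noteq> 2" and "CHAR('k) \<noteq> 3"
    and "lie_yamaguti_action scale br tr G act"
    and "equivariant_deformation scale br tr G act f g"
    and "equivariant_deformation scale br tr G act f' g'"
    and "equivalent_deformations scale G act f g f' g'"
  shows "\<exists>c \<in> cohomology scale br tr G act. (f 1, g 1) \<in> c \<and> (f' 1, g' 1) \<in> c"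
proof -
  let ?Z = "cocycles scale br tr G act" and ?R = "cohomologous scale br tr G act"
  have L: "lie_yamaguti scale br tr"
    using assms(3) by (rule lie_yamaguti_action.axioms(1))
  have Z: "(f 1, g 1) \<in> ?Z" "(f' 1, g' 1) \<in> ?Z"
    using deformation_infinitesimal_cocycle[OF assms(1) L] assms(4,5) by blast+
  then have R: "((f 1, g 1), (f' 1, g' 1)) \<in> ?R"
    using equivalent_deformations_infinitesimal_diff[OF L assms(4,5,6)]
    by (simp add: cohomologous_def)
  \<comment> \<open>The common class is that of \<open>(f 1, g 1)\<close>.\<close>
  have "?R `` {(f 1, g 1)} \<in> cohomology scale br tr G act"
    unfolding cohomology_def using Z(1) by (rule quotientI)
  moreover have "(f 1, g 1) \<in> ?R `` {(f 1, g 1)}"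
    using equiv_class_self[OF equiv_cohomologous[OF assms(3)] Z(1)] .
  ultimately show ?thesis
    using R by blast
qed

end
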